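(* Let $g(z)=\sum_{n=0}^\infty b_nz^n$ be analytic in the unit disc $\mathbb{D}$ with $b_n\ge0$ for all $n\in\mathbb{N}\cup\{0\}$. Then the following statements are equivalent: (1) The operator $\mathcal{H}_g:\mathcal{B}\to\mathcal{B}$ is bounded. (2) $g\in\mathcal{B}_{\log^{-1}}$. (3) $\displaystyle\sum_{n=1}^N nb_n\log(n+1)=O(N)$ as $N\to\infty$. (4) $\displaystyle\sum_{n=1}^N nb_n=O\left(\frac{N}{\log N}\right)$ as $N\to\infty$.
   Context: $\mathbb{D}$ is the open unit disc of $\mathbb{C}$ and $H(\mathbb{D})$ is the space of all analytic functions in $\mathbb{D}$. For $g\in H(\mathbb{D})$ the generalized Hilbert operator is $\mathcal{H}_g(f)(z)=\int_0^1 f(t)g'(tz)\,dt$, $z\in\mathbb{D}$, for $f\in H(\mathbb{D})$ with $\int_0^1|f(t)|\,dt<\infty$ (this holds for all $f\in\mathcal{B}$). For $\alpha\in\mathbb{R}$, the logarithmically weighted Bloch space $\mathcal{B}_{\log^\alpha}$ is the space of $f\in H(\mathbb{D})$ with $\|f\|_{\mathcal{B}_{\log^\alpha}}=|f(0)|+\sup_{z\in\mathbb{D}}(1-|z|^2)\left(\log\frac{e}{1-|z|^2}\right)^{-\alpha}|f'(z)|<\infty$. $\mathcal{B}=\mathcal{B}_{\log^0}$ is the Bloch space. *)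

theory Defs
  imports "HOL-Complex_Analysis.Complex_Analysis" "HOL-Library.Landau_Symbols"
begin

text \<open>
  Functions on the unit disc are total functions of type \<open>complex \<Rightarrow> complex\<close>; every notion
  below depends only on the values on \<open>ball 0 1\<close>.
\<close>

definition log_bloch_weighted_deriv :: "real \<Rightarrow> (complex \<Rightarrow> complex) \<Rightarrow> complex \<Rightarrow> real" where
  "log_bloch_weighted_deriv \<alpha> f z =
     (1 - (norm z)\<^sup>2) * ln (exp 1 / (1 - (norm z)\<^sup>2)) powr (- \<alpha>) * norm (deriv f z)"

definition log_bloch_norm :: "real \<Rightarrow> (complex \<Rightarrow> complex) \<Rightarrow> real" where
  "log_bloch_norm \<alpha> f = norm (f 0) + (SUP z\<in>ball 0 1. log_bloch_weighted_deriv \<alpha> f z)"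

text \<open>
  The supremum in \<^const>\<open>log_bloch_norm\<close> is real-valued, so its finiteness is expressed
  by \<^const>\<open>bdd_above\<close>.
\<close>

definition log_bloch :: "real \<Rightarrow> (complex \<Rightarrow> complex) set" where
  "log_bloch \<alpha> =
     {f. f holomorphic_on ball 0 1 \<and> bdd_above (log_bloch_weighted_deriv \<alpha> f ` ball 0 1)}"

abbreviation bloch_norm :: "(complex \<Rightarrow> complex) \<Rightarrow> real" where
  "bloch_norm \<equiv> log_bloch_norm 0"

abbreviation bloch :: "(complex \<Rightarrow> complex) set" where
  "bloch \<equiv> log_bloch 0"

text \<open>
  A Lebesgue integral, meaningful when \<open>f\<close> is absolutely integrable on \<open>[0,1)\<close>, which holds for
  every Bloch function: \<open>f\<close> is then \<open>O(ln (e / (1 - t)))\<close>, and \<open>t \<mapsto> g'(tz)\<close> is bounded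
  for fixed \<open>z\<close> in the disc. The endpoint \<open>1\<close> is a null set and is left out
  because \<open>f\<close> is arbitrary there.
\<close>

definition gen_hilbert_op :: "(complex \<Rightarrow> complex) \<Rightarrow> (complex \<Rightarrow> complex) \<Rightarrow> complex \<Rightarrow> complex"
  where
  "gen_hilbert_op g f z =
     (LINT t:{0..<1}|lborel. f (complex_of_real t) * deriv g (complex_of_real t * z))"

definition bounded_on_bloch :: "((complex \<Rightarrow> complex) \<Rightarrow> complex \<Rightarrow> complex) \<Rightarrow> bool" where
  "bounded_on_bloch T \<longleftrightarrow>
     (\<forall>f\<in>bloch. T f \<in> bloch) \<and> (\<exists>C. \<forall>f\<in>bloch. bloch_norm (T f) \<le> C * bloch_norm f)"

end

theory Submission
  imports Defs "HOL-Real_Asymp.Real_Asymp"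
begin

text \<open>
  Put \<open>B n = (n + 1) b(n + 1)\<close>, so that \<open>g'(z) = \<Sum> B n z^n\<close> and
  \<open>H_g f(z) = \<Sum> B n \<mu>(n) z^n\<close> with the moments \<open>\<mu>(n)\<close> of \<open>f\<close>
  on \<open>[0,1)\<close>. A Bloch function is dominated by a multiple of \<open>1 - ln (1 - t)\<close>, whose moments are
  \<open>(1 + harm (n + 1)) / (n + 1)\<close>, so \<open>H_g f\<close> has coefficients \<open>O(b(n + 1) ln (n + 2))\<close>, and (3)
  yields (1) by summation by parts. Conversely, for \<open>f(z) = - Ln (1 - z)\<close> the moments are exactly
  \<open>harm (n + 1) / (n + 1)\<close>, and because the coefficients are nonnegative the Bloch condition on
  \<open>H_g f\<close> at \<open>r = N / (N + 1)\<close> gives (3). Statements (2) and (4) are linked in the same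
  way through \<open>g'(r)\<close>.
\<close>

section \<open>Moments of the logarithm on \<open>[0,1)\<close>\<close>

text \<open>Integration by parts suggests an explicit antiderivative. As \<open>c \<ge> 0\<close>
  makes the integrand nonnegative, the limits of that antiderivative at the endpoints give
  integrability and the value together. The case \<open>c = 1\<close> yields the majorant for Bloch
  functions, \<open>c = 0\<close> the moments of the test function.\<close>

lemma log_moment:
  fixes c :: real and n :: nat
  assumes "c \<ge> 0"
  shows "set_integrable lborel {0..<1} (\<lambda>t. t ^ n * (c - ln (1 - t)))" (is ?int)
    and "(LINT t:{0..<1}|lborel. t ^ n * (c - ln (1 - t))) = (c + harm (Suc n)) / real (Suc n)"
      (is ?eq)
proof -
  define f where "f = (\<lambda>t::real. t ^ n * (c - ln (1 - t)))"
  \<comment> \<open>\<open>G\<close> is the antiderivative in the form convenient to differentiate, \<open>F\<close> the same function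
    in the form whose limit at \<open>1\<close> is visible.\<close>
  define F where "F = (\<lambda>t::real. (c * t ^ Suc n + (\<Sum>j<Suc n. t ^ j) * ((1 - t) * ln (1 - t))
      + (\<Sum>j<Suc n. t ^ Suc j / real (Suc j))) / real (Suc n))"
  define G where "G = (\<lambda>t::real. (c * t ^ Suc n + (1 - t ^ Suc n) * ln (1 - t)
      + (\<Sum>j<Suc n. t ^ Suc j / real (Suc j))) / real (Suc n))"
  have FG: "F = G"
    unfolding F_def G_def by (subst one_diff_power_eq) (simp add: mult_ac)
  have DG: "(G has_real_derivative f t) (at t)" if t: "0 < t" "t < 1" for t
  proof -
    have "(G has_real_derivative (c * (real (Suc n) * t ^ n) + ((1 - t ^ Suc n) * (- 1 / (1 - t))
        + (- (real (Suc n) * t ^ n)) * ln (1 - t)) + (\<Sum>j<Suc n. t ^ j)) / real (Suc n)) (at t)"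
      unfolding G_def using t
      by (auto intro!: derivative_eq_intros simp del: sum.lessThan_Suc power_Suc)
    \<comment> \<open>This term, which comes from differentiating \<open>ln (1 - t)\<close>, cancels
      the derivative of the last sum in \<open>G\<close>.\<close>
    moreover have "(1 - t ^ Suc n) * (- 1 / (1 - t)) = - (\<Sum>j<Suc n. t ^ j)"
      using t by (subst one_diff_power_eq) (simp add: field_simps)
    ultimately have "(G has_real_derivative (c * (real (Suc n) * t ^ n)
        + (- (real (Suc n) * t ^ n)) * ln (1 - t)) / real (Suc n)) (at t)"
      by simp
    moreover have "(c * (real (Suc n) * t ^ n)
        + (- (real (Suc n) * t ^ n)) * ln (1 - t)) / real (Suc n) = f t"
      unfolding f_def by (simp add: field_simps)
    ultimately show ?thesis by simp
  qed
  have lim1: "((\<lambda>t::real. (1 - t) * ln (1 - t)) \<longlongrightarrow> 0) (at_left 1)"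
    by real_asymp
  have "(F \<longlongrightarrow> (c * 1 ^ Suc n + (\<Sum>j<Suc n. 1 ^ j) * 0
      + (\<Sum>j<Suc n. 1 ^ Suc j / real (Suc j))) / real (Suc n)) (at_left 1)"
    unfolding F_def by (intro tendsto_intros lim1) auto
  moreover have "(\<Sum>j<Suc n. 1 ^ Suc j / real (Suc j)) = harm (Suc n)"
    by (simp add: harm_altdef divide_inverse)
  ultimately have L1: "(F \<longlongrightarrow> (c + harm (Suc n)) / real (Suc n)) (at_left 1)"
    by simp
  have "isCont F 0"
    unfolding F_def by (intro continuous_intros) auto
  moreover have "F 0 = 0"
    unfolding F_def by (simp add: sum.lessThan_Suc_shift del: sum.lessThan_Suc)
  ultimately have L0: "(F \<longlongrightarrow> 0) (at_right 0)"
    unfolding isCont_def by (metis filterlim_at_split)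
  have nonneg: "0 \<le> f t" if "0 < t" "t < 1" for t
    unfolding f_def using that assms by (intro mult_nonneg_nonneg) (auto intro: order_trans[of _ 0])
  have FTC: "set_integrable lborel (einterval 0 1) f"
    "(LBINT t=0..1. f t) = (c + harm (Suc n)) / real (Suc n) - 0"
  proof -
    have c1: "(0::ereal) < 1" by simp
    have c2: "\<And>x. 0 < ereal x \<Longrightarrow> ereal x < 1 \<Longrightarrow> DERIV F x :> f x"
      using DG FG by simp
    have c3: "\<And>x. 0 < ereal x \<Longrightarrow> ereal x < 1 \<Longrightarrow> isCont f x"
      unfolding f_def by (auto intro!: continuous_intros)
    have c4: "AE x in lborel. 0 < ereal x \<longrightarrow> ereal x < 1 \<longrightarrow> 0 \<le> f x"
      using nonneg by simp
    have c5: "((F \<circ> real_of_ereal) \<longlongrightarrow> 0) (at_right 0)"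
      using L0 by (simp add: zero_ereal_def ereal_tendsto_simps)
    have c6: "((F \<circ> real_of_ereal) \<longlongrightarrow> (c + harm (Suc n)) / real (Suc n)) (at_left 1)"
      using L1 by (simp add: one_ereal_def ereal_tendsto_simps)
    show "set_integrable lborel (einterval 0 1) f"
      "(LBINT t=0..1. f t) = (c + harm (Suc n)) / real (Suc n) - 0"
      using interval_integral_FTC_nonneg[OF c1 c2 c3 c4 c5 c6] by blast+
  qed
  have ei: "einterval 0 1 = {0<..<1::real}"
    by (auto simp: einterval_def)
  \<comment> \<open>The fundamental theorem speaks of the open interval; the two indicators differ
    only at the null point 0.\<close>
  have ae: "AE t in lborel. indicator {0<..<1} t *\<^sub>R f t = indicator {0..<1} t *\<^sub>R f t"
    using AE_lborel_singleton[of 0] by eventually_elim (auto simp: indicator_def)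
  have i1: "integrable lborel (\<lambda>t. indicator {0<..<1} t *\<^sub>R f t)"
    using FTC(1) ei by (simp add: set_integrable_def)
  have meas: "(\<lambda>t. indicator {0..<1} t *\<^sub>R f t) \<in> borel_measurable lborel"
    unfolding f_def by measurable
  show ?int
    using integrable_cong_AE_imp[OF i1 meas] ae unfolding set_integrable_def f_def
    by (metis (no_types, lifting) AE_cong)
  have "(LINT t:{0<..<1}|lborel. f t) = (LINT t:{0..<1}|lborel. f t)"
    unfolding set_lebesgue_integral_def
    using ae meas borel_measurable_integrable[OF i1] by (intro integral_cong_AE) auto
  then have "(LINT t:{0..<1}|lborel. f t) = (LBINT t=0..1. f t)"
    by (simp add: interval_lebesgue_integral_def ei)
  with FTC(2) show ?eq unfolding f_def by simp
qed

section \<open>Partial sums against radial growth of power series\<close>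

text \<open>Abel summation writes the weighted sum as a combination of partial sums with
  coefficients \<open>r ^ N\<close> and \<open>(1 - r) * r ^ n\<close>, which are nonnegative for
  \<open>0 \<le> r \<le> 1\<close>.\<close>

lemma sum_mult_power_mono:
  fixes a d :: "nat \<Rightarrow> real"
  assumes "\<And>N. (\<Sum>n<N. a n) \<le> (\<Sum>n<N. d n)" "0 \<le> r" "r \<le> 1"
  shows "(\<Sum>n<N. a n * r ^ n) \<le> (\<Sum>n<N. d n * r ^ n)"
proof -
  have abel: "(\<Sum>n<N. u n * r ^ n) =
      (\<Sum>n<N. u n) * r ^ N + (1 - r) * (\<Sum>n<N. (\<Sum>k<Suc n. u k) * r ^ n)" for u :: "nat \<Rightarrow> real" and N
    by (induction N) (simp_all add: algebra_simps)
  show ?thesis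
    unfolding abel[of a] abel[of d]
  proof (intro add_mono mult_left_mono)
    show "(\<Sum>n<N. (\<Sum>k<Suc n. a k) * r ^ n) \<le> (\<Sum>n<N. (\<Sum>k<Suc n. d k) * r ^ n)"
      using assms(2) by (intro sum_mono mult_right_mono assms(1)) auto
  qed (use assms in \<open>auto intro: mult_right_mono\<close>)
qed

text \<open>For \<open>N \<ge> 1\<close>, \<open>A * N + D\<close> is the partial sum of the
  constant sequence \<open>A\<close> with \<open>D\<close> added at index 0, and the power series of
  that sequence is \<open>A / (1 - r) + D\<close>.\<close>

lemma power_series_bound:
  fixes a :: "nat \<Rightarrow> real"
  assumes a: "\<And>n. a n \<ge> 0" and S: "\<And>N. (\<Sum>n<N. a n) \<le> A * real N + D" and D: "(0::real) \<le> A" "0 \<le> D"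
    and r: "0 \<le> r" "r < 1"
  shows "summable (\<lambda>n. a n * r ^ n)" "(\<Sum>n. a n * r ^ n) \<le> A / (1 - r) + D"
proof -
  define d where "d = (\<lambda>n::nat. A + (if n = 0 then D else 0))"
  have "(\<Sum>n<N. a n) \<le> (\<Sum>n<N. d n)" for N
    using S[of N] D by (cases "N = 0") (auto simp: d_def sum.distrib mult.commute)
  then have le: "(\<Sum>n<N. a n * r ^ n) \<le> (\<Sum>n<N. d n * r ^ n)" for N
    using r by (intro sum_mult_power_mono) auto
  have "(\<lambda>n. A * r ^ n + (if n = 0 then D else 0)) sums (A * (1 / (1 - r)) + D)"
    using r by (intro sums_add sums_mult geometric_sums sums_single) auto
  moreover have "(\<lambda>n. A * r ^ n + (if n = 0 then D else 0)) = (\<lambda>n. d n * r ^ n)"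
    by (auto simp: d_def)
  ultimately have d: "(\<lambda>n. d n * r ^ n) sums (A / (1 - r) + D)"
    by simp
  have d0: "0 \<le> d n" for n using D by (simp add: d_def)
  have le': "(\<Sum>n<N. a n * r ^ n) \<le> A / (1 - r) + D" for N
    using le[of N] sum_le_suminf[OF sums_summable[OF d], of "{..<N}"] d0 r sums_unique[OF d]
    by (force intro: order_trans)
  show *: "summable (\<lambda>n. a n * r ^ n)"
    by (rule summableI_nonneg_bounded[OF _ le']) (use a r in auto)
  show "(\<Sum>n. a n * r ^ n) \<le> A / (1 - r) + D"
    by (rule suminf_le_const[OF * le'])
qed

text \<open>The radius \<open>r = N / (N + 1)\<close> keeps \<open>r ^ n \<ge> 1 / 3\<close> for all
  \<open>n < N\<close>, because \<open>(1 / r) ^ N = (1 + 1 / N) ^ N \<le> exp 1 \<le> 3\<close>.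
  The remaining terms are nonnegative and may be added.\<close>

lemma power_series_partial_sum_bound:
  fixes a :: "nat \<Rightarrow> real"
  assumes a: "\<And>n. a n \<ge> 0" and s: "summable (\<lambda>n. a n * (real N / real (Suc N)) ^ n)"
  shows "(\<Sum>n<N. a n) \<le> 3 * (\<Sum>n. a n * (real N / real (Suc N)) ^ n)"
proof (cases "N = 0")
  case True
  then show ?thesis using a suminf_nonneg[OF s] by auto
next
  case False
  define r where "r = real N / real (Suc N)"
  have r: "0 < r" "r \<le> 1" using False by (auto simp: r_def)
  have rN: "1 \<le> 3 * r ^ n" if "n < N" for n
  proof -
    have "(1 + 1 / real N) ^ N \<le> exp 1"
      by (rule exp_ge_one_plus_x_over_n_power_n) (use False in auto)
    also have "\<dots> \<le> 3" by (rule exp_le)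
    finally have "(1 + 1 / real N) ^ N \<le> 3" .
    moreover have "1 + 1 / real N = inverse r"
      using False by (simp add: r_def field_simps)
    ultimately have "inverse (r ^ N) \<le> 3" by (simp add: power_inverse)
    then have "1 \<le> 3 * r ^ N" using r by (simp add: field_simps)
    also have "\<dots> \<le> 3 * r ^ n" using that r by (simp add: power_decreasing)
    finally show ?thesis .
  qed
  have "(\<Sum>n<N. a n) \<le> (\<Sum>n<N. 3 * (a n * r ^ n))"
  proof (rule sum_mono)
    fix n assume "n \<in> {..<N}"
    then have "a n * 1 \<le> a n * (3 * r ^ n)" using rN a by (intro mult_left_mono) auto
    then show "a n \<le> 3 * (a n * r ^ n)" by simp
  qed
  also have "\<dots> = 3 * (\<Sum>n<N. a n * r ^ n)" by (simp add: sum_distrib_left)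
  also have "(\<Sum>n<N. a n * r ^ n) \<le> (\<Sum>n. a n * r ^ n)"
    using s a r by (intro sum_le_suminf) (auto simp: r_def)
  finally show ?thesis by (simp add: r_def)
qed

lemma deriv_power_series_sums:
  fixes c :: "nat \<Rightarrow> complex"
  assumes "\<And>z. z \<in> ball 0 1 \<Longrightarrow> (\<lambda>n. c n * z ^ n) sums h z"
  shows "h holomorphic_on ball 0 1"
    and "z \<in> ball 0 1 \<Longrightarrow> (\<lambda>n. of_nat (Suc n) * c (Suc n) * z ^ n) sums deriv h z"
proof -
  show hol: "h holomorphic_on ball 0 1"
    by (rule power_series_holomorphic[where a = c]) (use assms in auto)
  assume z: "z \<in> ball 0 1"
  have "(\<lambda>n. diffs c n * z ^ n) sums deriv h z"
  proof (rule termdiffs_sums_strong)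
    show "(h has_field_derivative deriv h z) (at z)"
      using hol z by (meson holomorphic_derivI open_ball)
  qed (use assms z in auto)
  then show "(\<lambda>n. of_nat (Suc n) * c (Suc n) * z ^ n) sums deriv h z"
    by (simp add: diffs_def)
qed

section \<open>Bloch functions and their moments\<close>

lemma bloch_weighted_deriv_eq:
  assumes "z \<in> ball 0 1"
  shows "log_bloch_weighted_deriv 0 f z = (1 - (norm z)\<^sup>2) * norm (deriv f z)"
proof -
  have "0 < 1 - (norm z)\<^sup>2" using assms by (simp add: abs_square_less_1)
  \<comment> \<open>Since \<open>0 powr 0 = 0\<close>, the logarithm must be known to be nonzero
    before the exponent 0 removes it.\<close>
  then have "0 < ln (exp 1 / (1 - (norm z)\<^sup>2))"
    by (simp add: ln_div) (smt (verit) ln_le_minus_one zero_le_power2)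
  then show ?thesis by (simp add: log_bloch_weighted_deriv_def)
qed

lemma bloch_deriv_bound:
  assumes "f \<in> bloch" "z \<in> ball 0 1"
  shows "(1 - (norm z)\<^sup>2) * norm (deriv f z) \<le> bloch_norm f - norm (f 0)"
  using assms cSUP_upper[of z "ball 0 1" "log_bloch_weighted_deriv 0 f"]
  by (auto simp: log_bloch_def log_bloch_norm_def bloch_weighted_deriv_eq)

lemma bloch_norm_ge:
  assumes "f \<in> bloch"
  shows "norm (f 0) \<le> bloch_norm f"
  using bloch_deriv_bound[OF assms, of 0] by simp (smt (verit) norm_ge_zero)

text \<open>On the radius the derivative is at most
  \<open>M / (1 - x ^ 2) \<le> M / (1 - x)\<close>, which integrates to
  \<open>- M * ln (1 - t)\<close>. Both \<open>M\<close> and \<open>norm (f 0)\<close> are at most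
  the Bloch norm.\<close>

lemma bloch_growth:
  assumes f: "f \<in> bloch" and t: "0 \<le> t" "t < 1"
  shows "norm (f (of_real t)) \<le> bloch_norm f * (1 - ln (1 - t))"
proof -
  define M where "M = bloch_norm f - norm (f 0)"
  have M: "(1 - (norm z)\<^sup>2) * norm (deriv f z) \<le> M" if "z \<in> ball 0 1" for z
    unfolding M_def using bloch_deriv_bound[OF f that] .
  have hol: "f holomorphic_on ball 0 1" using f by (simp add: log_bloch_def)
  have M0: "0 \<le> M" using M[of 0] by simp (smt (verit) norm_ge_zero)
  have "norm (f (of_real t) - f (of_real 0)) \<le> - M * ln (1 - t) - (- M * ln (1 - 0))"
  proof (cases "t = 0")
    case False
    have d: "((\<lambda>x. f (of_real x)) has_vector_derivative deriv f (of_real x)) (at x)"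
      if "0 \<le> x" "x \<le> t" for x
    proof -
      have "(f has_field_derivative deriv f (of_real x)) (at (of_real x))"
        using hol that t by (intro holomorphic_derivI[of _ "ball 0 1"]) auto
      from field_vector_diff_chain_at[OF has_vector_derivative_of_real[OF DERIV_ident] this]
      show ?thesis by (simp add: o_def)
    qed
    show ?thesis
    proof (rule differentiable_bound_general[where f' = "\<lambda>x. deriv f (of_real x)" and \<phi>' = "\<lambda>x. M / (1 - x)"])
      show "0 < t" using t False by simp
      show "continuous_on {0..t} (\<lambda>x. f (of_real x))"
        using d by (intro continuous_at_imp_continuous_on ballI)
          (force intro: has_vector_derivative_continuous)
      show "continuous_on {0..t} (\<lambda>a. - M * ln (1 - a))"
        using t by (intro continuous_intros) auto
      show "((\<lambda>x. f (of_real x)) has_vector_derivative deriv f (of_real x)) (at x)"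
        if "0 < x" "x < t" for x using d that by simp
      show "((\<lambda>a. - M * ln (1 - a)) has_vector_derivative M / (1 - x)) (at x)"
        if "0 < x" "x < t" for x
        using that t
        by (auto intro!: derivative_eq_intros simp flip: has_real_derivative_iff_has_vector_derivative)
      show "norm (deriv f (of_real x)) \<le> M / (1 - x)" if "0 < x" "x < t" for x
      proof -
        have "(1 - x) * norm (deriv f (of_real x)) \<le> (1 - x\<^sup>2) * norm (deriv f (of_real x))"
          using that t by (intro mult_right_mono) (auto simp: power2_eq_square mult_left_le)
        also have "\<dots> \<le> M" using M[of "of_real x"] that t by simp
        finally show ?thesis using that t by (simp add: field_simps)
      qed
    qed
  qed simp
  then have "norm (f (of_real t)) \<le> norm (f 0) + M * (- ln (1 - t))"
    using norm_triangle_ineq2[of "f (of_real t)" "f 0"] by simp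
  also have "\<dots> \<le> bloch_norm f * 1 + bloch_norm f * (- ln (1 - t))"
    using t M0 bloch_norm_ge[OF f] by (intro add_mono mult_right_mono) (auto simp: M_def)
  finally show ?thesis by (simp add: algebra_simps)
qed

lemma two_thirds_le_ln: "2 / 3 \<le> ln (real n + 2)"
  by (rule order_trans[OF ln2_ge_two_thirds]) simp

text \<open>The difference \<open>harm m - ln m\<close> decreases from its value 1 at
  \<open>m = 1\<close>; the leftover constant 2 is absorbed by \<open>3 * ln (n + 2)\<close>, since
  \<open>ln 2 \<ge> 2 / 3\<close>.\<close>

lemma harm_le_ln:
  "1 + harm (Suc n) \<le> 4 * ln (real n + 2)"
proof -
  have "harm (Suc n) - ln (real (Suc n)) \<le> harm 1 - ln (real 1)"
    using euler_mascheroni_sequence_decreasing[of 1 "Suc n"] by simp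
  then have "1 + harm (Suc n) \<le> 2 + ln (real n + 1)"
    by (simp add: harm_expand add.commute)
  also have "\<dots> \<le> 4 * ln (real n + 2)"
  proof -
    have "ln (real n + 1) \<le> ln (real n + 2)" by simp
    then show ?thesis using two_thirds_le_ln[of n] by linarith
  qed
  finally show ?thesis .
qed

text \<open>Domination by the growth bound. The integral of the modulus is estimated, not just the
  modulus of the integral, because termwise integration needs absolute moments.\<close>

lemma bloch_moment:
  assumes f: "f \<in> bloch"
  defines "u \<equiv> \<lambda>n t. indicator {0..<1} t *\<^sub>R (f (of_real t) * of_real t ^ n)"
  shows "integrable lborel (u n)"
    and "(LINT t|lborel. norm (u n t)) \<le> bloch_norm f * ((1 + harm (Suc n)) / real (Suc n))"
proof -
  let ?k = "\<lambda>t. bloch_norm f * (indicator {0..<1} t *\<^sub>R (t ^ n * (1 - ln (1 - t))))"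
  have k: "integrable lborel ?k"
    using log_moment(1)[of 1 n] by (simp add: set_integrable_def)
  have le: "norm (u n t) \<le> ?k t" for t
  proof (cases "t \<in> {0..<1}")
    case True
    then have "norm (f (of_real t)) * t ^ n \<le> bloch_norm f * (1 - ln (1 - t)) * t ^ n"
      using bloch_growth[OF f] by (intro mult_right_mono) auto
    then show ?thesis using True by (simp add: u_def norm_mult norm_power mult_ac)
  qed (simp add: u_def)
  \<comment> \<open>\<open>f\<close> is arbitrary off the disc, so measurability comes from
    continuity on \<open>[0,1)\<close> together with the indicator.\<close>
  have "continuous_on {0..<1} (\<lambda>t. f (of_real t))"
  proof (rule continuous_on_compose2[of "ball 0 1" f])
    show "continuous_on (ball 0 1) f"
      using f by (auto simp: log_bloch_def intro: holomorphic_on_imp_continuous_on)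
  qed (auto intro!: continuous_intros)
  then have "continuous_on {0..<1} (\<lambda>t. f (of_real t) * of_real t ^ n)"
    by (intro continuous_intros)
  then have m: "u n \<in> borel_measurable lborel"
    unfolding u_def by (simp add: borel_measurable_continuous_on_indicator)
  show i: "integrable lborel (u n)"
  proof (rule Bochner_Integration.integrable_bound[OF k m], rule AE_I2)
    show "norm (u n t) \<le> norm (?k t)" for t
      using order_trans[OF le[of t] abs_ge_self] by simp
  qed
  have "(LINT t|lborel. norm (u n t)) \<le> (LINT t|lborel. ?k t)"
    using i k le by (intro integral_mono) auto
  also have "\<dots> = bloch_norm f * ((1 + harm (Suc n)) / real (Suc n))"
    using log_moment(2)[of 1 n] by (simp add: set_lebesgue_integral_def)
  finally show "(LINT t|lborel. norm (u n t)) \<le> bloch_norm f * ((1 + harm (Suc n)) / real (Suc n))" .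
qed

definition moment :: "(complex \<Rightarrow> complex) \<Rightarrow> nat \<Rightarrow> complex" where
  "moment f n = (LINT t:{0..<1}|lborel. f (of_real t) * of_real t ^ n)"

lemma norm_moment_le:
  assumes f: "f \<in> bloch"
  shows "norm (moment f n) \<le> bloch_norm f * ((1 + harm (Suc n)) / real (Suc n))"
  unfolding moment_def set_lebesgue_integral_def
  using bloch_moment(2)[OF f, of n] integral_norm_bound by (rule order_trans[rotated])

section \<open>Power series of the generalized Hilbert operator\<close>

text \<open>The series of \<open>deriv g (t * z)\<close> is integrated term by term. The interchange
  rests on absolute convergence of the derivative series at \<open>z\<close> and on a bound for the
  absolute moments of \<open>f\<close> that is uniform in \<open>n\<close>.\<close>

lemma gen_hilbert_op_sums:
  assumes g: "\<And>z. z \<in> ball 0 1 \<Longrightarrow> (\<lambda>n. a n * z ^ n) sums g z"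
    and f: "f \<in> bloch" and z: "z \<in> ball 0 1"
  shows "(\<lambda>n. of_nat (Suc n) * a (Suc n) * moment f n * z ^ n) sums gen_hilbert_op g f z"
proof -
  define c where "c = (\<lambda>n. of_nat (Suc n) * a (Suc n) * z ^ n)"
  define v where "v = (\<lambda>n t. indicator {0..<1} t *\<^sub>R (f (of_real t) * of_real t ^ n))"
  have dg: "(\<lambda>n. of_nat (Suc n) * a (Suc n) * w ^ n) sums deriv g w" if "w \<in> ball 0 1" for w
    using deriv_power_series_sums(2)[OF g that] .
  \<comment> \<open>A point of modulus strictly between \<open>norm z\<close> and 1: convergence at
    \<open>w\<close> forces absolute convergence at \<open>z\<close>.\<close>
  define w where "w = complex_of_real ((norm z + 1) / 2)"
  have nw: "norm w = (norm z + 1) / 2"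
    unfolding w_def by (simp only: norm_of_real) auto
  have "summable (\<lambda>n. of_nat (Suc n) * a (Suc n) * w ^ n)"
    using dg[of w] nw z by (auto simp: sums_iff)
  then have sc: "summable (\<lambda>n. norm (c n))"
    unfolding c_def by (rule powser_insidea) (use nw z in auto)
  have vi: "integrable lborel (v n)" for n
    unfolding v_def by (rule bloch_moment(1)[OF f])
  \<comment> \<open>The crude estimate \<open>harm m \<le> m\<close> suffices, as only uniformity in
    \<open>n\<close> matters here.\<close>
  have harm_le: "(1 + harm (Suc n)) / real (Suc n) \<le> 2" for n
  proof -
    have "harm (Suc n) = (\<Sum>k<Suc n. inverse (real (Suc k)))" by (rule harm_altdef)
    also have "\<dots> \<le> (\<Sum>k<Suc n. 1)" by (intro sum_mono) (simp add: field_simps)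
    finally show ?thesis by (simp add: field_simps)
  qed
  have n0: "0 \<le> bloch_norm f" using bloch_norm_ge[OF f] norm_ge_zero order_trans by blast
  have vle: "(LINT t|lborel. norm (v n t)) \<le> bloch_norm f * 2" for n
    using bloch_moment(2)[OF f, of n] mult_left_mono[OF harm_le[of n] n0] unfolding v_def by linarith
  have "(\<lambda>n. LINT t|lborel. c n * v n t) sums (LINT t|lborel. (\<Sum>n. c n * v n t))"
  proof (rule sums_integral)
    show "integrable lborel (\<lambda>t. c n * v n t)" for n using vi by simp
    show "AE t in lborel. summable (\<lambda>n. norm (c n * v n t))"
    proof (rule AE_I2)
      fix t :: real
      show "summable (\<lambda>n. norm (c n * v n t))"
      proof (rule summable_comparison_test'[OF summable_mult[OF sc, of "norm (f (of_real t))"]])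
        fix n
        have "norm (v n t) \<le> norm (f (of_real t)) * 1"
          unfolding v_def by (auto simp: indicator_def norm_mult norm_power power_le_one mult_left_le)
        then have "norm (c n) * norm (v n t) \<le> norm (c n) * (norm (f (of_real t)) * 1)"
          by (intro mult_left_mono) auto
        then show "norm (norm (c n * v n t)) \<le> norm (f (of_real t)) * norm (c n)"
          by (simp add: norm_mult mult_ac)
      qed
    qed
    show "summable (\<lambda>n. LINT t|lborel. norm (c n * v n t))"
    proof (rule summable_comparison_test'[OF summable_mult[OF sc, of "bloch_norm f * 2"]])
      fix n
      have "(LINT t|lborel. norm (c n * v n t)) = norm (c n) * (LINT t|lborel. norm (v n t))"
        by (simp add: norm_mult)
      also have "\<dots> \<le> norm (c n) * (bloch_norm f * 2)"
        using vle by (intro mult_left_mono) auto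
      finally show "norm (LINT t|lborel. norm (c n * v n t)) \<le> bloch_norm f * 2 * norm (c n)"
        by (simp add: mult_ac)
    qed
  qed
  moreover have "(LINT t|lborel. c n * v n t) = of_nat (Suc n) * a (Suc n) * moment f n * z ^ n" for n
  proof -
    have "(LINT t|lborel. c n * v n t) = c n * moment f n"
      unfolding moment_def set_lebesgue_integral_def v_def by (rule integral_mult_right_zero)
    then show ?thesis by (simp add: c_def)
  qed
  moreover have "(\<Sum>n. c n * v n t) =
      indicator {0..<1} t *\<^sub>R (f (of_real t) * deriv g (of_real t * z))" for t
  proof (cases "t \<in> {0..<1}")
    case True
    then have "norm (of_real t * z) < 1"
      using z by (simp add: norm_mult) (smt (verit) mult_left_le_one_le norm_ge_zero)
    from sums_mult[OF dg, of "of_real t * z" "f (of_real t)"] this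
    have "(\<lambda>n. f (of_real t) * (of_nat (Suc n) * a (Suc n) * (of_real t * z) ^ n)) sums
        (f (of_real t) * deriv g (of_real t * z))" by simp
    moreover have "f (of_real t) * (of_nat (Suc n) * a (Suc n) * (of_real t * z) ^ n) = c n * v n t" for n
      using True by (simp add: c_def v_def power_mult_distrib del: of_nat_Suc)
    ultimately show ?thesis using True by (simp add: sums_iff)
  qed (simp add: v_def)
  ultimately show ?thesis
    by (simp add: gen_hilbert_op_def set_lebesgue_integral_def)
qed

section \<open>Coefficients and the Bloch norm\<close>

text \<open>Nonnegative coefficients allow no cancellation on the positive radius. This turns Bloch
  bounds on a derivative into bounds on a real series.\<close>

lemma nonneg_power_series_norm:
  fixes a :: "nat \<Rightarrow> real"
  assumes "\<And>n. a n \<ge> 0" "r \<ge> 0" "(\<lambda>n. complex_of_real (a n) * of_real r ^ n) sums w"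
  shows "summable (\<lambda>n. a n * r ^ n)" "(\<Sum>n. a n * r ^ n) = norm w"
proof -
  have *: "(\<lambda>n. complex_of_real (a n * r ^ n)) sums w" using assms(3) by simp
  then show s: "summable (\<lambda>n. a n * r ^ n)" using sums_summable summable_complex_of_real by blast
  have "w = of_real (\<Sum>n. a n * r ^ n)"
    using sums_unique2[OF * sums_of_real[OF summable_sums[OF s]]] .
  then show "(\<Sum>n. a n * r ^ n) = norm w"
    using suminf_nonneg[OF s] assms by simp
qed

text \<open>The derivative at modulus \<open>r\<close> is at most \<open>A / (1 - r) + D\<close>.
  Multiplying by \<open>1 - r ^ 2 = (1 + r) * (1 - r)\<close> leaves at most
  \<open>2 * A + D\<close>.\<close>

lemma power_series_in_bloch:
  assumes h: "\<And>z. z \<in> ball 0 1 \<Longrightarrow> (\<lambda>n. c n * z ^ n) sums h z"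
    and S: "\<And>N. (\<Sum>n<N. real (Suc n) * norm (c (Suc n))) \<le> A * real N + D"
    and A: "0 \<le> A" "0 \<le> D"
  shows "h \<in> bloch" "bloch_norm h \<le> norm (c 0) + (2 * A + D)"
proof -
  have le: "log_bloch_weighted_deriv 0 h z \<le> 2 * A + D" if z: "z \<in> ball 0 1" for z
  proof -
    define r where "r = norm z"
    have r: "0 \<le> r" "r < 1" using z by (auto simp: r_def)
    let ?a = "\<lambda>n. real (Suc n) * norm (c (Suc n))"
    have a0: "0 \<le> ?a n" for n by simp
    note b = power_series_bound[OF a0 S A r]
    have "deriv h z = (\<Sum>n. of_nat (Suc n) * c (Suc n) * z ^ n)"
      using deriv_power_series_sums(2)[OF h z] by (simp add: sums_iff)
    also have "norm \<dots> \<le> (\<Sum>n. ?a n * r ^ n)"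
      by (rule norm_suminf_le) (use b in \<open>auto simp: norm_mult norm_power r_def simp del: of_nat_Suc\<close>)
    also have "\<dots> \<le> A / (1 - r) + D" by (rule b)
    finally have "norm (deriv h z) \<le> A / (1 - r) + D" .
    then have "(1 - r\<^sup>2) * norm (deriv h z) \<le> (1 - r\<^sup>2) * (A / (1 - r) + D)"
      using r by (intro mult_left_mono) (auto simp: power_le_one)
    also have "\<dots> = (1 + r) * A + (1 - r\<^sup>2) * D"
      using r by (simp add: field_simps power2_eq_square)
    also have "\<dots> \<le> 2 * A + 1 * D"
      using r A by (intro add_mono mult_right_mono) auto
    finally show ?thesis using bloch_weighted_deriv_eq[OF z] by (simp add: r_def)
  qed
  have "h holomorphic_on ball 0 1" by (rule deriv_power_series_sums(1)[OF h])
  with le show "h \<in> bloch"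
    unfolding log_bloch_def by (auto intro!: bdd_aboveI2)
  have "h 0 = c 0"
    by (rule sums_unique2[OF h powser_sums_zero]) simp
  moreover have "(SUP z\<in>ball 0 1. log_bloch_weighted_deriv 0 h z) \<le> 2 * A + D"
    by (rule cSUP_least) (use le in auto)
  ultimately show "bloch_norm h \<le> norm (c 0) + (2 * A + D)"
    unfolding log_bloch_norm_def by simp
qed

section \<open>Partial sums with and without logarithmic weights\<close>

text \<open>Abel summation needs a bound at every \<open>N\<close>, not only eventually. The
  finitely many early sums are absorbed by enlarging the constant; at \<open>N = 0\<close> both
  sides vanish.\<close>

lemma bigo_linear_partial_sums_iff:
  fixes w :: "nat \<Rightarrow> real"
  assumes w: "\<And>n. w n \<ge> 0"
  shows "(\<lambda>N. \<Sum>n<N. w n) \<in> O[at_top](\<lambda>N. real N) \<longleftrightarrow>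
    (\<exists>C\<ge>0. \<forall>N. (\<Sum>n<N. w n) \<le> C * real N)"
proof
  assume "(\<lambda>N. \<Sum>n<N. w n) \<in> O[at_top](\<lambda>N. real N)"
  then obtain C where "C > 0" "eventually (\<lambda>N. norm (\<Sum>n<N. w n) \<le> C * norm (real N)) at_top"
    by (auto elim: landau_o.bigE)
  then obtain N0 where N0: "\<And>N. N \<ge> N0 \<Longrightarrow> \<bar>\<Sum>n<N. w n\<bar> \<le> C * real N"
    unfolding eventually_at_top_linorder by auto
  define D where "D = (\<Sum>n<N0. w n)"
  have D: "0 \<le> D" unfolding D_def using w by (intro sum_nonneg)
  have "(\<Sum>n<N. w n) \<le> (C + D) * real N" for N
  proof (cases "N = 0 \<or> N \<ge> N0")
    case True
    then show ?thesis using N0[of N] mult_nonneg_nonneg[OF D, of "real N"] by (auto simp: algebra_simps)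
  next
    case False
    then have "(\<Sum>n<N. w n) \<le> D * 1"
      unfolding D_def using w by (auto intro!: sum_mono2)
    also have "\<dots> \<le> D * real N" using D False by (intro mult_left_mono) auto
    also have "\<dots> \<le> (C + D) * real N" using \<open>C > 0\<close> by (intro mult_right_mono) auto
    finally show ?thesis .
  qed
  then show "\<exists>C\<ge>0. \<forall>N. (\<Sum>n<N. w n) \<le> C * real N"
    using D \<open>C > 0\<close> by (intro exI[of _ "C + D"]) auto
next
  assume "\<exists>C\<ge>0. \<forall>N. (\<Sum>n<N. w n) \<le> C * real N"
  then obtain C where "\<And>N. (\<Sum>n<N. w n) \<le> C * real N" by auto
  then show "(\<lambda>N. \<Sum>n<N. w n) \<in> O[at_top](\<lambda>N. real N)"
    using w by (intro bigoI[of _ C] always_eventually) (simp add: sum_nonneg)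
qed

lemma log_times_partial_sum_le:
  fixes B :: "nat \<Rightarrow> real"
  assumes B: "\<And>n. B n \<ge> 0" and C: "\<And>N. (\<Sum>n<N. B n * ln (real n + 2)) \<le> C * real N"
  shows "(\<Sum>n<N. B n) * ln (real N + 1) \<le> 6 * C * real N"
proof (cases "N = 0")
  case False
  \<comment> \<open>For \<open>n\<close> beyond \<open>sqrt N\<close> the weights \<open>ln (n + 2)\<close> and \<open>ln (N + 1)\<close> are comparable; the
    terms before contribute only \<open>O(sqrt N ln N)\<close>.\<close>
  define k where "k = nat \<lfloor>sqrt (real N)\<rfloor>"
  define L where "L = ln (real N + 1)"
  have L0: "0 \<le> L" by (simp add: L_def)
  have C0: "0 \<le> C"
    using C[of 1] mult_nonneg_nonneg[OF B[of 0], of "ln 2"] by simp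
  have k: "real k \<le> sqrt (real N)" unfolding k_def by simp
  \<comment> \<open>\<open>ln y \<le> y - 1\<close> is used at \<open>y = sqrt (N + 1)\<close>, so
    that \<open>L\<close> times \<open>sqrt N\<close> is \<open>O(N)\<close>.\<close>
  have "L = 2 * ln (sqrt (real N + 1))" unfolding L_def by (simp add: ln_sqrt)
  also have "\<dots> \<le> 2 * (sqrt (real N + 1) - 1)"
    by (intro mult_left_mono ln_le_minus_one) auto
  also have "sqrt (real N + 1) \<le> sqrt (real N) + 1"
    using sqrt_add_le_add_sqrt[of "real N" 1] by simp
  finally have L: "L \<le> 2 * sqrt (real N)" by simp
  have split: "B n * L \<le> 2 * (B n * ln (real n + 2)) + (if n < k then B n * L else 0)" if "n < N" for n
  proof (cases "n < k")
    case True
    then show ?thesis using B[of n] by simp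
  next
    case False
    \<comment> \<open>The choice of \<open>k\<close> gives
      \<open>N + 1 \<le> (k + 1) ^ 2 + 1 \<le> (n + 2) ^ 2\<close>, hence
      \<open>L \<le> 2 * ln (n + 2)\<close>.\<close>
    have "sqrt (real N) \<le> real k + 1" unfolding k_def by linarith
    then have "real N \<le> (real k + 1)\<^sup>2" by (rule sqrt_le_D)
    also have "\<dots> \<le> (real n + 1)\<^sup>2" using False by (intro power_mono) auto
    also have "\<dots> + 1 \<le> (real n + 2)\<^sup>2" by (simp add: power2_eq_square algebra_simps)
    finally have "real N + 1 \<le> (real n + 2)\<^sup>2" by simp
    then have "L \<le> ln ((real n + 2)\<^sup>2)" unfolding L_def by (subst ln_le_cancel_iff) auto
    also have "\<dots> = 2 * ln (real n + 2)" by (simp add: ln_realpow)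
    finally have "B n * L \<le> B n * (2 * ln (real n + 2))" using B by (intro mult_left_mono)
    then show ?thesis using False by simp
  qed
  have "sqrt (real N) \<le> real N"
    using False by (intro real_le_lsqrt) (auto simp: power2_eq_square)
  with k have "k \<le> N" by linarith
  then have sk: "(\<Sum>n<N. if n < k then B n * L else 0) = (\<Sum>n<k. B n) * L"
    by (subst sum.inter_filter[symmetric]) (auto simp: sum_distrib_right intro!: sum.cong)
  \<comment> \<open>The hypothesis is applied at \<open>k\<close> itself; all weights are at least
    \<open>1 / 2\<close>, so dropping them costs a factor 2.\<close>
  have "(\<Sum>n<k. B n) * (1/2) \<le> (\<Sum>n<k. B n * ln (real n + 2))"
    unfolding sum_distrib_right
  proof (intro sum_mono mult_left_mono B)
    show "1 / 2 \<le> ln (real n + 2)" for n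
      using two_thirds_le_ln[of n] by simp
  qed
  also have "\<dots> \<le> C * real k" by (rule C)
  also have "\<dots> \<le> C * sqrt (real N)" using k C0 by (rule mult_left_mono)
  finally have S: "(\<Sum>n<k. B n) \<le> 2 * C * sqrt (real N)" by simp
  have "(\<Sum>n<k. B n) * L \<le> (2 * C * sqrt (real N)) * (2 * sqrt (real N))"
    using S L L0 C0 by (intro mult_mono) auto
  also have "\<dots> = 4 * C * (sqrt (real N) * sqrt (real N))" by (simp only: mult_ac)
  finally have S': "(\<Sum>n<k. B n) * L \<le> 4 * C * real N" by simp
  \<comment> \<open>The constant 6 is 2 from the comparison of weights for \<open>n \<ge> k\<close>
    plus 4 from the terms with \<open>n < k\<close>.\<close>
  have "(\<Sum>n<N. B n) * L \<le> (\<Sum>n<N. 2 * (B n * ln (real n + 2)) + (if n < k then B n * L else 0))"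
    unfolding sum_distrib_right by (intro sum_mono split) auto
  also have "\<dots> = 2 * (\<Sum>n<N. B n * ln (real n + 2)) + (\<Sum>n<k. B n) * L"
    by (simp add: sum.distrib sum_distrib_left sk)
  also have "\<dots> \<le> 2 * (C * real N) + 4 * C * real N"
    using C[of N] S' by simp
  finally show ?thesis by (simp add: L_def)
qed simp

text \<open>Removing the weights is the preceding estimate. Inserting them is easier: each is at
  most \<open>ln (N + 1)\<close>, and \<open>N + 1 \<le> N ^ 2\<close> bounds this by
  \<open>2 * ln N\<close> for \<open>N \<ge> 2\<close>.\<close>

lemma log_weighted_sum_bigo_iff:
  fixes B :: "nat \<Rightarrow> real"
  assumes B: "\<And>n. B n \<ge> 0"
  shows "(\<lambda>N. \<Sum>n<N. B n * ln (real n + 2)) \<in> O[at_top](\<lambda>N. real N) \<longleftrightarrow>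
    (\<lambda>N. \<Sum>n<N. B n) \<in> O[at_top](\<lambda>N. real N / ln (real N))"
proof
  assume "(\<lambda>N. \<Sum>n<N. B n * ln (real n + 2)) \<in> O[at_top](\<lambda>N. real N)"
  then obtain C where C: "C \<ge> 0" "\<And>N. (\<Sum>n<N. B n * ln (real n + 2)) \<le> C * real N"
    using bigo_linear_partial_sums_iff[of "\<lambda>n. B n * ln (real n + 2)"] B by auto
  show "(\<lambda>N. \<Sum>n<N. B n) \<in> O[at_top](\<lambda>N. real N / ln (real N))"
  proof (rule bigoI[of _ "6 * C"])
    show "\<forall>\<^sub>F N in sequentially. norm (\<Sum>n<N. B n) \<le> 6 * C * norm (real N / ln (real N))"
      \<comment> \<open>From 2 on \<open>ln N\<close> is positive; at \<open>N = 1\<close> the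
        quotient \<open>N / ln N\<close> has the default value 0.\<close>
      using eventually_ge_at_top[of 2]
    proof eventually_elim
      case (elim N)
      have S: "0 \<le> (\<Sum>n<N. B n)" by (simp add: B sum_nonneg)
      have "(\<Sum>n<N. B n) * ln (real N) \<le> (\<Sum>n<N. B n) * ln (real N + 1)"
        using elim S by (intro mult_left_mono) auto
      also have "\<dots> \<le> 6 * C * real N" by (rule log_times_partial_sum_le[OF B C(2)])
      finally show ?case using elim S by (simp add: field_simps)
    qed
  qed
next
  assume "(\<lambda>N. \<Sum>n<N. B n) \<in> O[at_top](\<lambda>N. real N / ln (real N))"
  then obtain C where C: "C > 0"
    and ev: "eventually (\<lambda>N. norm (\<Sum>n<N. B n) \<le> C * norm (real N / ln (real N))) at_top"
    by (auto elim: landau_o.bigE)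
  show "(\<lambda>N. \<Sum>n<N. B n * ln (real n + 2)) \<in> O[at_top](\<lambda>N. real N)"
  proof (rule bigoI[of _ "2 * C"])
    show "\<forall>\<^sub>F N in sequentially. norm (\<Sum>n<N. B n * ln (real n + 2)) \<le> 2 * C * norm (real N)"
      using ev eventually_ge_at_top[of 2]
    proof eventually_elim
      case (elim N)
      have lnN: "0 < ln (real N)" using elim by simp
      have "2 * real N \<le> real N ^ 2"
        unfolding power2_eq_square using elim by (intro mult_right_mono) auto
      then have "real N + 1 \<le> real N ^ 2" using elim by linarith
      then have "ln (real N + 1) \<le> ln (real N ^ 2)"
        using elim by (subst ln_le_cancel_iff) auto
      then have l2: "ln (real N + 1) \<le> 2 * ln (real N)"
        using elim by (simp add: ln_realpow)
      have "(\<Sum>n<N. B n * ln (real n + 2)) \<le> (\<Sum>n<N. B n) * ln (real N + 1)"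
        unfolding sum_distrib_right using B by (intro sum_mono mult_left_mono) auto
      also have "\<dots> \<le> (C * (real N / ln (real N))) * (2 * ln (real N))"
        using elim(1) lnN l2 C by (intro mult_mono) auto
      also have "\<dots> = 2 * C * real N" using lnN by simp
      finally show ?case using B by (simp add: sum_nonneg)
    qed
  qed
qed

text \<open>
  Replaces the partial-sum bound \<open>N / ln (N + 1)\<close> by one affine in \<open>N\<close>, for each fixed
  \<open>x = 1 / (1 - r)\<close>, so that comparison with a geometric series suffices.
\<close>

lemma log_comparison:
  assumes "N \<ge> 1" "x \<ge> (1::real)"
  shows "1 + ln x \<le> ln (real N + 1) * (1 + 2 * x / real N)"
proof -
  \<comment> \<open>\<open>ln y \<le> y - 1\<close> at \<open>y = x / N\<close> trades
    \<open>ln x\<close> for \<open>ln N\<close> at the price \<open>x / N\<close>; the factor 2 in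
    the claim pays for \<open>ln (N + 1) \<ge> 1 / 2\<close>.\<close>
  have "ln (x / real N) \<le> x / real N - 1" using assms by (intro ln_le_minus_one) auto
  then have "1 + ln x \<le> ln (real N) + x / real N" using assms by (simp add: ln_div)
  also have "ln (real N) \<le> ln (real N + 1)" using assms by simp
  also have "x / real N \<le> ln (real N + 1) * (2 * x / real N)"
  proof -
    have "real (N - 1) + 2 = real N + 1" using assms by (simp add: of_nat_diff)
    with two_thirds_le_ln[of "N - 1"] have "2 / 3 \<le> ln (real N + 1)" by (simp only:)
    then have "1 / 2 \<le> ln (real N + 1)" by (rule order_trans[rotated]) simp
    then have "(1 / 2) * (2 * x / real N) \<le> ln (real N + 1) * (2 * x / real N)"
      using assms by (intro mult_right_mono) auto
    then show ?thesis by simp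
  qed
  finally show ?thesis by (simp add: algebra_simps)
qed

section \<open>The weight for exponent -1 and the logarithmic test function\<close>

lemma log_bloch_weighted_deriv_minus_one:
  assumes "z \<in> ball 0 1"
  shows "log_bloch_weighted_deriv (-1) f z =
    (1 - (norm z)\<^sup>2) * (1 - ln (1 - (norm z)\<^sup>2)) * norm (deriv f z)"
    and "1 \<le> 1 - ln (1 - (norm z)\<^sup>2)"
proof -
  have *: "0 < 1 - (norm z)\<^sup>2" using assms by (simp add: abs_square_less_1)
  then show "1 \<le> 1 - ln (1 - (norm z)\<^sup>2)" by simp
  then have "0 < 1 - ln (1 - (norm z)\<^sup>2)" by linarith
  with * show "log_bloch_weighted_deriv (-1) f z =
    (1 - (norm z)\<^sup>2) * (1 - ln (1 - (norm z)\<^sup>2)) * norm (deriv f z)"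
    by (simp add: log_bloch_weighted_deriv_def ln_div)
qed

text \<open>The derivative is \<open>1 / (1 - z)\<close>, and
  \<open>norm (1 - z) \<ge> 1 - norm z\<close> bounds the weighted derivative by
  \<open>1 + norm z \<le> 2\<close>. On the positive radius this function has the full logarithmic
  growth allowed to Bloch functions.\<close>

lemma neg_Ln_in_bloch: "(\<lambda>z. - Ln (1 - z)) \<in> bloch"
proof -
  let ?f = "\<lambda>z. - Ln (1 - z)"
  have re: "0 < Re (1 - z)" if "z \<in> ball 0 1" for z :: complex
    using that complex_Re_le_cmod[of z] by simp
  have deriv: "(?f has_field_derivative 1 / (1 - z)) (at z)" if "z \<in> ball 0 1" for z
    using re[OF that]
    by (auto intro!: derivative_eq_intros simp: complex_nonpos_Reals_iff divide_inverse)
  then have "?f holomorphic_on ball 0 1"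
    unfolding holomorphic_on_open[OF open_ball] by blast
  moreover have "log_bloch_weighted_deriv 0 ?f z \<le> 2" if z: "z \<in> ball 0 1" for z
  proof -
    have n1: "norm z < 1" using z by simp
    have "1 - norm z \<le> norm (1 - z)" using norm_triangle_ineq2[of 1 z] by simp
    then have "(1 + norm z) * (1 - norm z) \<le> 2 * norm (1 - z)"
      using n1 by (intro mult_mono) auto
    moreover have "1 - z \<noteq> 0" using re[OF z] by force
    ultimately have "(1 - (norm z)\<^sup>2) * (1 / norm (1 - z)) \<le> 2"
      by (simp add: pos_divide_le_eq power2_eq_square algebra_simps)
    then show ?thesis
      using DERIV_imp_deriv[OF deriv[OF z]] by (simp add: bloch_weighted_deriv_eq[OF z] norm_divide)
  qed
  ultimately show ?thesis unfolding log_bloch_def by (auto intro!: bdd_aboveI2)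
qed

text \<open>On \<open>[0,1)\<close> the complex logarithm reduces to the real one, so this is the
  logarithmic moment with \<open>c = 0\<close>.\<close>

lemma moment_neg_Ln:
  "moment (\<lambda>z. - Ln (1 - z)) n = complex_of_real (harm (Suc n) / real (Suc n))"
proof -
  have "moment (\<lambda>z. - Ln (1 - z)) n = (LINT t:{0..<1}|lborel. complex_of_real (t ^ n * (0 - ln (1 - t))))"
    unfolding moment_def
  proof (rule set_lebesgue_integral_cong)
    show "\<forall>t. t \<in> {0..<1} \<longrightarrow>
      - Ln (1 - of_real t) * of_real t ^ n = complex_of_real (t ^ n * (0 - ln (1 - t)))"
    proof (intro allI impI)
      fix t :: real assume "t \<in> {0..<1}"
      then have "Ln (complex_of_real (1 - t)) = of_real (ln (1 - t))" by (intro Ln_of_real) auto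
      then show "- Ln (1 - of_real t) * of_real t ^ n = complex_of_real (t ^ n * (0 - ln (1 - t)))"
        by simp
    qed
  qed simp
  also have "\<dots> = complex_of_real (harm (Suc n) / real (Suc n))"
    unfolding set_integral_complex_of_real using log_moment(2)[of 0 n] by simp
  finally show ?thesis .
qed

section \<open>Implications for a symbol with nonnegative coefficients\<close>

locale nonneg_power_series =
  fixes g :: "complex \<Rightarrow> complex" and b :: "nat \<Rightarrow> real"
  assumes g_sums: "\<And>z. z \<in> ball 0 1 \<Longrightarrow> (\<lambda>n. complex_of_real (b n) * z ^ n) sums g z"
    and b_nonneg: "\<And>n. b n \<ge> 0"
begin

definition B :: "nat \<Rightarrow> real" where "B n = real (Suc n) * b (Suc n)"

lemma B_nonneg: "B n \<ge> 0"
  unfolding B_def by (intro mult_nonneg_nonneg b_nonneg) auto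

lemma sum_eq_B:
  "(\<Sum>n=1..N. real n * b n * ln (real n + 1)) = (\<Sum>n<N. B n * ln (real n + 2))"
  "(\<Sum>n=1..N. real n * b n) = (\<Sum>n<N. B n)"
  unfolding B_def One_nat_def sum.atLeast1_atMost_eq by (simp_all add: add.commute)

lemma deriv_sums:
  assumes "z \<in> ball 0 1"
  shows "(\<lambda>n. complex_of_real (B n) * z ^ n) sums deriv g z"
  using deriv_power_series_sums(2)[OF g_sums assms] by (simp add: B_def)

text \<open>For fixed \<open>r\<close> the unweighted partial sums are bounded affinely in
  \<open>N\<close> with slope \<open>6 * C / L\<close>, which yields
  \<open>norm (deriv g z) \<le> 18 * C * x / L\<close>. The weight is at most
  \<open>2 * (1 - r) * L\<close>, and \<open>(1 - r) * x = 1\<close> leaves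
  \<open>36 * C\<close>.\<close>

lemma log_bloch_if_weighted_sums:
  assumes C: "\<And>N. (\<Sum>n<N. B n * ln (real n + 2)) \<le> C * real N" and C0: "C \<ge> 0"
  shows "g \<in> log_bloch (-1)"
proof -
  have "log_bloch_weighted_deriv (-1) g z \<le> 36 * C" if z: "z \<in> ball 0 1" for z
  proof -
    define r where "r = norm z"
    have r: "0 \<le> r" "r < 1" using z by (auto simp: r_def)
    define x where "x = 1 / (1 - r)"
    have x: "x \<ge> 1" using r by (simp add: x_def)
    define L where "L = 1 + ln x"
    have L: "L > 0" using x by (simp add: L_def add_pos_nonneg)
    have S: "(\<Sum>n<N. B n) \<le> (6 * C / L) * real N + 12 * C * x / L" for N
    proof (cases "N = 0")
      case True
      then show ?thesis using C0 x L by simp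
    next
      case False
      have lnN: "0 < ln (real N + 1)" using False by simp
      have "(\<Sum>n<N. B n) \<le> 6 * C * real N / ln (real N + 1)"
        using log_times_partial_sum_le[OF B_nonneg C, of N] lnN by (simp add: field_simps)
      also have "\<dots> \<le> 6 * C * real N * ((1 + 2 * x / real N) / L)"
      proof -
        have "1 / ln (real N + 1) \<le> (1 + 2 * x / real N) / L"
          using log_comparison[of N x] False x L lnN
          by (simp add: L_def pos_divide_le_eq pos_le_divide_eq mult.commute)
        then have "6 * C * real N * (1 / ln (real N + 1)) \<le> 6 * C * real N * ((1 + 2 * x / real N) / L)"
          using C0 by (intro mult_left_mono) auto
        then show ?thesis by simp
      qed
      also have "\<dots> = (6 * C / L) * real N + 12 * C * x / L"
        using False L by (simp add: field_simps)
      finally show ?thesis .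
    qed
    have A: "0 \<le> 6 * C / L" "0 \<le> 12 * C * x / L" using C0 L x by auto
    note b = power_series_bound[OF B_nonneg S A r]
    have "deriv g z = (\<Sum>n. complex_of_real (B n) * z ^ n)"
      using deriv_sums[OF z] by (simp add: sums_iff)
    also have "norm \<dots> \<le> (\<Sum>n. B n * r ^ n)"
      by (rule norm_suminf_le) (use b B_nonneg in \<open>auto simp: norm_mult norm_power r_def\<close>)
    also have "\<dots> \<le> 18 * C * x / L"
      using b(2) L by (simp add: x_def field_simps)
    finally have d: "norm (deriv g z) \<le> 18 * C * x / L" .
    have r2: "0 < 1 - r\<^sup>2" "1 - r\<^sup>2 = (1 + r) * (1 - r)" "1 - r \<le> 1 - r\<^sup>2"
      using r by (auto simp: power2_eq_square algebra_simps mult_left_le abs_square_less_1[unfolded power2_eq_square])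
    \<comment> \<open>\<open>L\<close> was built from \<open>1 - r\<close>, whereas the weight
      involves \<open>1 - r ^ 2\<close>; the latter is larger, so its logarithmic factor is at most
      \<open>L\<close>.\<close>
    have "ln (1 - r) \<le> ln (1 - r\<^sup>2)" using r r2 by (subst ln_le_cancel_iff) auto
    then have L2: "1 - ln (1 - r\<^sup>2) \<le> L" using r by (simp add: L_def x_def ln_div)
    have "(1 - r\<^sup>2) * (1 - ln (1 - r\<^sup>2)) \<le> (2 * (1 - r)) * L"
    proof (rule mult_mono)
      show "1 - r\<^sup>2 \<le> 2 * (1 - r)"
        unfolding r2(2) using r by (intro mult_right_mono) auto
    qed (use L2 r log_bloch_weighted_deriv_minus_one(2)[OF z] in \<open>auto simp: r_def\<close>)
    then have "(1 - r\<^sup>2) * (1 - ln (1 - r\<^sup>2)) * norm (deriv g z) \<le> ((2 * (1 - r)) * L) * (18 * C * x / L)"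
      by (rule mult_mono) (use d r L in simp_all)
    also have "\<dots> = 36 * C * ((1 - r) * x)" using L by simp
    also have "\<dots> = 36 * C" using r by (simp add: x_def)
    finally show ?thesis using log_bloch_weighted_deriv_minus_one(1)[OF z] by (simp add: r_def)
  qed
  moreover have "g holomorphic_on ball 0 1" by (rule deriv_power_series_sums(1)[OF g_sums])
  ultimately show ?thesis unfolding log_bloch_def by (auto intro!: bdd_aboveI2)
qed

text \<open>At \<open>r = N / (N + 1)\<close> the factor \<open>1 - r\<close> is
  \<open>1 / (N + 1)\<close> and the logarithmic weight is at least \<open>ln N\<close>. The
  constant is 3 from truncating the series, doubled by \<open>N + 1 \<le> 2 * N\<close>.\<close>

lemma sums_bigo_if_log_bloch:
  assumes "g \<in> log_bloch (-1)"
  shows "(\<lambda>N. \<Sum>n<N. B n) \<in> O[at_top](\<lambda>N. real N / ln (real N))"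
proof -
  obtain M where M: "\<And>z. z \<in> ball 0 1 \<Longrightarrow> log_bloch_weighted_deriv (-1) g z \<le> M"
    using assms unfolding log_bloch_def bdd_above_def by blast
  have M0: "0 \<le> M"
    using M[of 0] log_bloch_weighted_deriv_minus_one(1)[of 0 g] by simp (smt (verit) norm_ge_zero)
  show ?thesis
  proof (rule bigoI[of _ "6 * M"])
    show "\<forall>\<^sub>F N in sequentially. norm (\<Sum>n<N. B n) \<le> 6 * M * norm (real N / ln (real N))"
      using eventually_ge_at_top[of 2]
    proof eventually_elim
      case (elim N)
      define r where "r = real N / real (Suc N)"
      have r: "0 \<le> r" "r < 1" by (auto simp: r_def)
      have r1: "1 - r = 1 / (real N + 1)" by (simp add: r_def field_simps)
      have z: "complex_of_real r \<in> ball 0 1" using r by simp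
      note s = nonneg_power_series_norm[OF B_nonneg r(1) deriv_sums[OF z]]
      have S: "(\<Sum>n<N. B n) \<le> 3 * norm (deriv g (of_real r))"
        using power_series_partial_sum_bound[where a = B and N = N, OF B_nonneg] s by (simp only: r_def)
      have lnN: "0 < ln (real N)" using elim by simp
      have r2: "0 < 1 - r\<^sup>2" "1 - r \<le> 1 - r\<^sup>2" "1 - r\<^sup>2 = (1 + r) * (1 - r)"
        using r by (auto simp: power2_eq_square algebra_simps mult_left_le abs_square_less_1[unfolded power2_eq_square])
      \<comment> \<open>The loss of \<open>ln 2\<close> caused by the factor
        \<open>1 + r \<le> 2\<close> is covered by the summand 1 in the weight.\<close>
      have "1 - r\<^sup>2 \<le> 2 * (1 - r)" unfolding r2(3) using r by (intro mult_right_mono) auto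
      then have "ln (1 - r\<^sup>2) \<le> ln (2 * (1 - r))" using r r2 by (subst ln_le_cancel_iff) auto
      also have "\<dots> = ln 2 - ln (real N + 1)" by (simp add: r1 ln_div)
      also have "\<dots> \<le> 1 - ln (real N)"
        using elim ln2_le_25_over_36 by (intro diff_mono) auto
      finally have l: "ln (real N) \<le> 1 - ln (1 - r\<^sup>2)" by simp
      have "(1 - r) * ln (real N) * norm (deriv g (of_real r))
          \<le> (1 - r\<^sup>2) * (1 - ln (1 - r\<^sup>2)) * norm (deriv g (of_real r))"
        using r2 l lnN by (intro mult_right_mono mult_mono) auto
      also have "\<dots> \<le> M"
        using M[OF z] log_bloch_weighted_deriv_minus_one(1)[OF z] by simp
      finally have "norm (deriv g (of_real r)) \<le> M * (real N + 1) / ln (real N)"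
        using lnN by (simp add: r1 field_simps)
      also have "\<dots> \<le> M * (2 * real N) / ln (real N)"
        using lnN M0 elim by (intro divide_right_mono mult_left_mono) auto
      finally have "(\<Sum>n<N. B n) \<le> 6 * M * (real N / ln (real N))"
        using S by simp
      then show ?case using lnN by (simp add: B_nonneg sum_nonneg)
    qed
  qed
qed

lemma gen_hilbert_op_coeff_sums:
  assumes "f \<in> bloch" "z \<in> ball 0 1"
  shows "(\<lambda>n. complex_of_real (B n) * moment f n * z ^ n) sums gen_hilbert_op g f z"
  using gen_hilbert_op_sums[OF g_sums assms] by (simp add: B_def)

text \<open>The moment bound gives
  \<open>(n + 1) * norm (c n) \<le> 4 * K * B n * ln (n + 2)\<close> for the coefficients
  \<open>c n\<close> of the image of a Bloch function of norm \<open>K\<close>, so the hypothesis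
  controls the partial sums of its derivative.\<close>

lemma bounded_if_weighted_sums:
  assumes C: "\<And>N. (\<Sum>n<N. B n * ln (real n + 2)) \<le> C * real N" and C0: "C \<ge> 0"
  shows "bounded_on_bloch (gen_hilbert_op g)"
proof -
  have "gen_hilbert_op g f \<in> bloch \<and> bloch_norm (gen_hilbert_op g f) \<le> 16 * C * bloch_norm f"
    if f: "f \<in> bloch" for f
  proof -
    let ?K = "bloch_norm f"
    have K0: "0 \<le> ?K" using bloch_norm_ge[OF f] norm_ge_zero order_trans by blast
    let ?c = "\<lambda>n. complex_of_real (B n) * moment f n"
    have c: "real (Suc n) * norm (?c n) \<le> 4 * ?K * (B n * ln (real n + 2))" for n
    proof -
      have "real (Suc n) * norm (moment f n) \<le> real (Suc n) * (?K * ((1 + harm (Suc n)) / real (Suc n)))"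
        using norm_moment_le[OF f] by (intro mult_left_mono) auto
      also have "\<dots> = ?K * (1 + harm (Suc n))" by (simp del: of_nat_Suc)
      also have "\<dots> \<le> ?K * (4 * ln (real n + 2))"
        using harm_le_ln K0 by (intro mult_left_mono)
      finally have "B n * (real (Suc n) * norm (moment f n)) \<le> B n * (?K * (4 * ln (real n + 2)))"
        using B_nonneg by (intro mult_left_mono)
      then show ?thesis using B_nonneg by (simp add: norm_mult mult_ac)
    qed
    have "(\<Sum>n<N. real (Suc n) * norm (?c (Suc n))) \<le> (4 * ?K * C) * real N + 4 * ?K * C" for N
    proof -
      \<comment> \<open>Raising \<open>n + 1\<close> to \<open>n + 2\<close> makes this a tail of
        the sum of \<open>(n + 1) * norm (c n)\<close> over \<open>n < N + 1\<close>; the additional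
        index produces the additive constant.\<close>
      have "(\<Sum>n<N. real (Suc n) * norm (?c (Suc n)))
          \<le> (\<Sum>n<N. real (Suc (Suc n)) * norm (?c (Suc n)))"
        by (intro sum_mono mult_right_mono) auto
      also have "\<dots> \<le> (\<Sum>n<Suc N. real (Suc n) * norm (?c n))"
        by (subst sum.lessThan_Suc_shift) (auto intro!: mult_nonneg_nonneg)
      also have "\<dots> \<le> (\<Sum>n<Suc N. 4 * ?K * (B n * ln (real n + 2)))"
        by (intro sum_mono c)
      also have "\<dots> = 4 * ?K * (\<Sum>n<Suc N. B n * ln (real n + 2))"
        by (simp only: sum_distrib_left)
      also have "\<dots> \<le> 4 * ?K * (C * real (Suc N))"
        using K0 by (intro mult_left_mono C) auto
      finally show ?thesis by (simp add: algebra_simps)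
    qed
    note b = power_series_in_bloch[OF gen_hilbert_op_coeff_sums[OF f] this]
    have KC: "0 \<le> 4 * ?K * C" using K0 C0 by simp
    \<comment> \<open>In units of \<open>K * C\<close>, the constant term contributes 4 and the
      derivative bound \<open>2 * 4 + 4\<close>, which makes 16.\<close>
    have "norm (?c 0) \<le> 4 * ?K * (B 0 * ln 2)" using c[of 0] by simp
    also have "\<dots> \<le> 4 * ?K * C" using C[of 1] K0 by (intro mult_left_mono) auto
    finally have "norm (?c 0) \<le> 4 * ?K * C" .
    then show ?thesis using b(1)[OF _ KC KC] b(2)[OF _ KC KC] by (simp add: algebra_simps)
  qed
  then show ?thesis
    unfolding bounded_on_bloch_def by (intro conjI exI[of _ "16 * C"] ballI) simp_all
qed

text \<open>The image of \<open>- Ln (1 - z)\<close> has nonnegative coefficients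
  \<open>B n * harm (n + 1) / (n + 1)\<close>. Its Bloch bound at \<open>r = N / (N + 1)\<close>
  therefore controls partial sums, and \<open>harm\<close> dominates the logarithm.\<close>

lemma weighted_sums_if_bounded:
  assumes "bounded_on_bloch (gen_hilbert_op g)"
  shows "\<exists>C\<ge>0. \<forall>N. (\<Sum>n<N. B n * ln (real n + 2)) \<le> C * real N"
proof -
  define f where "f = (\<lambda>z. - Ln (1 - z))"
  have f: "f \<in> bloch" unfolding f_def by (rule neg_Ln_in_bloch)
  have mom: "moment f n = complex_of_real (harm (Suc n) / real (Suc n))" for n
    unfolding f_def by (rule moment_neg_Ln)
  have T: "gen_hilbert_op g f \<in> bloch"
    using assms f by (simp add: bounded_on_bloch_def)
  define M where "M = bloch_norm (gen_hilbert_op g f)"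
  have M: "(1 - (norm z)\<^sup>2) * norm (deriv (gen_hilbert_op g f) z) \<le> M" if "z \<in> ball 0 1" for z
    using bloch_deriv_bound[OF T that] norm_ge_zero[of "gen_hilbert_op g f 0"] unfolding M_def by linarith
  have M0: "0 \<le> M" using M[of 0] by simp (smt (verit) norm_ge_zero)
  \<comment> \<open>These are the coefficients of the derivative of the image. Differentiation loses
    \<open>B 0\<close>, which is added back at the end.\<close>
  define a where "a = (\<lambda>n. real (Suc n) * (B (Suc n) * (harm (Suc (Suc n)) / real (Suc (Suc n)))))"
  have a0: "0 \<le> a n" for n
    unfolding a_def by (intro mult_nonneg_nonneg divide_nonneg_nonneg B_nonneg harm_nonneg) auto
  have dsums: "(\<lambda>n. complex_of_real (a n) * z ^ n) sums deriv (gen_hilbert_op g f) z"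
    if "z \<in> ball 0 1" for z
    using deriv_power_series_sums(2)[OF gen_hilbert_op_coeff_sums[OF f] that] by (simp add: a_def mom mult_ac)
  have S: "(\<Sum>n<N. a n) \<le> 3 * M * real (Suc N)" for N
  proof -
    define r where "r = real N / real (Suc N)"
    have r: "0 \<le> r" "r < 1" by (auto simp: r_def)
    have r1: "1 - r = 1 / real (Suc N)" by (simp add: r_def field_simps)
    have z: "complex_of_real r \<in> ball 0 1" using r by simp
    note s = nonneg_power_series_norm[OF a0 r(1) dsums[OF z]]
    have 1: "(\<Sum>n<N. a n) \<le> 3 * norm (deriv (gen_hilbert_op g f) (of_real r))"
      using power_series_partial_sum_bound[where a = a and N = N, OF a0] s by (simp only: r_def)
    have "(1 - r) * norm (deriv (gen_hilbert_op g f) (of_real r))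
        \<le> (1 - r\<^sup>2) * norm (deriv (gen_hilbert_op g f) (of_real r))"
      using r by (intro mult_right_mono) (auto simp: power2_eq_square mult_left_le)
    also have "\<dots> \<le> M" using M[OF z] by simp
    finally have "norm (deriv (gen_hilbert_op g f) (of_real r)) \<le> M * real (Suc N)"
      unfolding r1 by (simp add: field_simps)
    with 1 show ?thesis by simp
  qed
  \<comment> \<open>The factor 2 comes from \<open>(n + 2) / (n + 1) \<le> 2\<close>.\<close>
  have Ba: "B (Suc n) * ln (real (Suc n) + 2) \<le> 2 * a n" for n
  proof -
    have "ln (real (Suc n) + 2) \<le> harm (Suc (Suc n))"
      using ln_le_harm[of "Suc (Suc n)"] by (simp add: add_ac)
    also have "\<dots> \<le> (2 * real (Suc n) / real (Suc (Suc n))) * harm (Suc (Suc n))"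
    proof -
      have "1 \<le> 2 * real (Suc n) / real (Suc (Suc n))" by (simp add: field_simps)
      from mult_right_mono[OF this harm_nonneg[of "Suc (Suc n)"]] show ?thesis by simp
    qed
    finally have "B (Suc n) * ln (real (Suc n) + 2)
        \<le> B (Suc n) * ((2 * real (Suc n) / real (Suc (Suc n))) * harm (Suc (Suc n)))"
      using B_nonneg by (intro mult_left_mono)
    also have "\<dots> = 2 * a n" by (simp only: a_def times_divide_eq_left times_divide_eq_right mult_ac)
    finally show ?thesis .
  qed
  have D: "0 \<le> B 0 * ln 2" using B_nonneg by simp
  have "(\<Sum>n<N. B n * ln (real n + 2)) \<le> (B 0 * ln 2 + 6 * M) * real N" for N
  proof (cases N)
    case (Suc m)
    have "(\<Sum>n<N. B n * ln (real n + 2)) = B 0 * ln 2 + (\<Sum>n<m. B (Suc n) * ln (real (Suc n) + 2))"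
      unfolding Suc by (subst sum.lessThan_Suc_shift) simp
    also have "(\<Sum>n<m. B (Suc n) * ln (real (Suc n) + 2)) \<le> (\<Sum>n<m. 2 * a n)"
      by (intro sum_mono Ba)
    also have "\<dots> = 2 * (\<Sum>n<m. a n)" by (simp only: sum_distrib_left)
    \<comment> \<open>With \<open>N = m + 1\<close> the bound \<open>S\<close> at \<open>m\<close>
      reads \<open>3 * M * N\<close>; moreover \<open>N \<ge> 1\<close> lets the term with
      \<open>B 0\<close> be multiplied by \<open>N\<close>.\<close>
    also have "\<dots> \<le> 2 * (3 * M * real N)" using S[of m] Suc by simp
    also have "B 0 * ln 2 + 2 * (3 * M * real N) \<le> (B 0 * ln 2) * real N + 6 * M * real N"
      using D Suc mult_left_mono[of 1 "real N" "B 0 * ln 2"] by simp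
    finally show ?thesis by (simp add: algebra_simps)
  qed simp
  then show ?thesis using D M0 by (intro exI[of _ "B 0 * ln 2 + 6 * M"]) auto
qed

end

theorem theorem4p7:
  fixes g :: "complex \<Rightarrow> complex" and b :: "nat \<Rightarrow> real"
  assumes "g holomorphic_on ball 0 1"
    and "\<And>z. z \<in> ball 0 1 \<Longrightarrow> (\<lambda>n. complex_of_real (b n) * z ^ n) sums g z"
    and "\<And>n. b n \<ge> 0"
  shows "(bounded_on_bloch (gen_hilbert_op g) \<longleftrightarrow> g \<in> log_bloch (-1))
    \<and> (g \<in> log_bloch (-1) \<longleftrightarrow>
         (\<lambda>N::nat. \<Sum>n=1..N. real n * b n * ln (real n + 1)) \<in> O[at_top](\<lambda>N. real N))
    \<and> ((\<lambda>N::nat. \<Sum>n=1..N. real n * b n * ln (real n + 1)) \<in> O[at_top](\<lambda>N. real N) \<longleftrightarrow>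
         (\<lambda>N::nat. \<Sum>n=1..N. real n * b n) \<in> O[at_top](\<lambda>N. real N / ln (real N)))"
proof -
  interpret nonneg_power_series g b by unfold_locales (use assms in auto)
  have iff: "(\<lambda>N. \<Sum>n<N. B n * ln (real n + 2)) \<in> O[at_top](\<lambda>N. real N) \<longleftrightarrow>
      (\<exists>C\<ge>0. \<forall>N. (\<Sum>n<N. B n * ln (real n + 2)) \<le> C * real N)"
    by (rule bigo_linear_partial_sums_iff) (simp add: B_nonneg)
  have "bounded_on_bloch (gen_hilbert_op g) \<longleftrightarrow>
      (\<lambda>N. \<Sum>n<N. B n * ln (real n + 2)) \<in> O[at_top](\<lambda>N. real N)"
    unfolding iff using weighted_sums_if_bounded bounded_if_weighted_sums by metis
  moreover have "(\<lambda>N. \<Sum>n<N. B n * ln (real n + 2)) \<in> O[at_top](\<lambda>N. real N) \<longleftrightarrow>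
      (\<lambda>N. \<Sum>n<N. B n) \<in> O[at_top](\<lambda>N. real N / ln (real N))"
    by (rule log_weighted_sum_bigo_iff) (rule B_nonneg)
  \<comment> \<open>Membership of \<open>g\<close> is placed between the two sum conditions, already
    known to be equivalent: the weighted one implies it, and it implies the unweighted one.\<close>
  moreover have "g \<in> log_bloch (-1)"
    if "(\<lambda>N. \<Sum>n<N. B n * ln (real n + 2)) \<in> O[at_top](\<lambda>N. real N)"
    using that unfolding iff using log_bloch_if_weighted_sums by metis
  ultimately show ?thesis
    unfolding sum_eq_B using sums_bigo_if_log_bloch by argo
qed

end
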